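(* Let $1\le\delta<\Delta$ be integers, $\tilde h:\mathbb{Z}^+\to\mathbb{R}^+$ a positive non-increasing function and $\mathcal{J}(G)=\sum_{u\in V(G)}\tilde h(d_u)$. If $G\in\mathcal{K}_{\delta,\Delta}$, then $G$ is minimal for $\mathcal{J}$ on $\mathfrak{G}^{\Delta+2}_{\delta,\Delta}$. Moreover, if either $\delta$ is even and $\tilde h(\Delta-1)>\tilde h(\Delta)$, or $\delta$ is odd and $\tilde h(\Delta-2)>\tilde h(\Delta-1)>\tilde h(\Delta)$, then a graph $G\in\mathfrak{G}^{\Delta+2}_{\delta,\Delta}$ is minimal for $\mathcal{J}$ on $\mathfrak{G}^{\Delta+2}_{\delta,\Delta}$ if and only if $G\in\mathcal{K}_{\delta,\Delta}$.
   Context: All graphs are finite and simple; $d_u$ is the degree of $u$. $\mathfrak{G}^n_{\delta,\Delta}$ is the family of graphs with $n$ vertices, minimum degree $\delta$ and maximum degree $\Delta$. For $1\le\delta<\Delta$, $\mathcal{K}_{\delta,\Delta}$ is the family of graphs with $\Delta+2$ vertices, one of which has degree $\delta$, and such that: if $\delta$ is even, the other $\Delta+1$ vertices have degree $\Delta$; if $\delta$ is odd, $\Delta$ of the other vertices have degree $\Delta$ and the last vertex has degree $\Delta-1$. A graph $G$ in a family $\mathcal{F}$ is minimal for $\mathcal{J}$ on $\mathcal{F}$ if $\mathcal{J}(G)\le\mathcal{J}(\Gamma)$ for all $\Gamma\in\mathcal{F}$. *)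

theory Defs
  imports Complex_Main "Graph_Theory.Pair_Digraph"
begin

text \<open>
  A finite simple graph is a \<open>pair_graph\<close>: a finite vertex set with a symmetric, irreflexive
  arc relation on it. The edge \<open>uv\<close> is represented by the two arcs \<open>(u, v)\<close> and \<open>(v, u)\<close>, so
  the number of arcs leaving \<open>u\<close> is the number of edges at \<open>u\<close>.
\<close>

definition vdeg :: "'a pair_pre_digraph \<Rightarrow> 'a \<Rightarrow> nat" where
  "vdeg G u = out_degree (with_proj G) u"

definition min_deg :: "'a pair_pre_digraph \<Rightarrow> nat" where
  "min_deg G = Min (vdeg G ` pverts G)"

definition max_deg :: "'a pair_pre_digraph \<Rightarrow> nat" where
  "max_deg G = Max (vdeg G ` pverts G)"

definition graph_family :: "nat \<Rightarrow> nat \<Rightarrow> nat \<Rightarrow> 'a pair_pre_digraph set" where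
  "graph_family n \<delta> \<Delta> =
     {G. pair_graph G \<and> card (pverts G) = n \<and> min_deg G = \<delta> \<and> max_deg G = \<Delta>}"

definition K_family :: "nat \<Rightarrow> nat \<Rightarrow> 'a pair_pre_digraph set" where
  "K_family \<delta> \<Delta> =
     {G. pair_graph G \<and> card (pverts G) = \<Delta> + 2 \<and>
         (\<exists>w \<in> pverts G. vdeg G w = \<delta> \<and>
            (if even \<delta>
             then \<forall>u \<in> pverts G - {w}. vdeg G u = \<Delta>
             else \<exists>z \<in> pverts G - {w}. vdeg G z = \<Delta> - 1 \<and>
                    (\<forall>u \<in> pverts G - {w, z}. vdeg G u = \<Delta>)))}"

definition J_index :: "(nat \<Rightarrow> real) \<Rightarrow> 'a pair_pre_digraph \<Rightarrow> real" where
  "J_index h G = (\<Sum>u \<in> pverts G. h (vdeg G u))"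

text \<open>
  All members of a family share the vertex type \<open>'a\<close>. In a family of graphs with a fixed number
  of vertices this loses no generality: if the family has a member, then every graph with that
  many vertices is isomorphic to one with vertices in \<open>'a\<close>.
\<close>

definition minimal_on ::
  "('a pair_pre_digraph \<Rightarrow> real) \<Rightarrow> 'a pair_pre_digraph set \<Rightarrow> 'a pair_pre_digraph \<Rightarrow> bool" where
  "minimal_on J F G \<longleftrightarrow> G \<in> F \<and> (\<forall>\<Gamma> \<in> F. J G \<le> J \<Gamma>)"

end

theory Submission
  imports Defs
begin

text \<open>
  Some vertex has degree \<open>\<delta>\<close> and all the others have degree at most \<open>\<Delta>\<close>; if \<open>\<delta>\<close> is odd, then by
  the handshake lemma they cannot all have degree \<open>\<Delta>\<close>, so one of them has degree at most
  \<open>\<Delta> - 1\<close>. As the function is non-increasing, this bounds the index from below by its value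
  on \<open>\<K>\<close>. The converse needs \<open>\<K>\<close> to be nonempty: the complement of a member consists of a star
  with \<open>\<Delta> + 1 - \<delta>\<close> leaves and a matching of the other vertices, where for odd \<open>\<delta>\<close> the last
  unmatched vertex is matched with a leaf.
\<close>

section \<open>Vertex degrees and the handshake lemma\<close>

lemma vdeg_eq_card: "vdeg G u = card {v. (u, v) \<in> parcs G}"
proof -
  have "out_arcs (with_proj G) u = Pair u ` {v. (u, v) \<in> parcs G}"
    by (auto simp: out_arcs_def)
  then show ?thesis
    by (simp add: vdeg_def out_degree_def card_image inj_on_def)
qed

text \<open>Each pair \<open>(u, v)\<close> cancels against its reverse, which is a different pair
  by irreflexivity. Removing both keeps the relation symmetric and irreflexive, so induction
  applies.\<close>

lemma even_card_sym_irrefl: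
  assumes "finite A" "sym A" "irrefl A"
  shows "even (card A)"
  using assms
proof (induction A rule: finite_psubset_induct)
  case (psubset A)
  show ?case
  proof (cases "A = {}")
    case False
    then obtain u v where uv: "(u, v) \<in> A" by auto
    then have vu: "(v, u) \<in> A" and neq: "u \<noteq> v"
      using psubset.prems by (auto dest: symD simp: irrefl_def)
    let ?B = "A - {(u, v), (v, u)}"
    have "even (card ?B)"
      using psubset.prems uv by (intro psubset.IH) (auto simp: sym_def irrefl_def)
    moreover have "card A = card ?B + card {(u, v), (v, u)}"
      using uv vu psubset.hyps
      by (metis (no_types, lifting) card_Diff_subset card_mono empty_subsetI finite.emptyI
          finite.insertI insert_subset le_add_diff_inverse2)
    ultimately show ?thesis using neq by simp
  qed simp
qed

text \<open>Sorting the arcs by their tails shows that the degree sum is the number of arcs, and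
  arcs come in reversed pairs.\<close>

lemma handshake_even:
  assumes "pair_graph G"
  shows "even (\<Sum>u\<in>pverts G. vdeg G u)"
proof -
  interpret pair_graph G by fact
  have "parcs G = (SIGMA u:pverts G. {v. (u, v) \<in> parcs G})"
    by (auto dest: in_arcsD1)
  moreover have "finite {v. (u, v) \<in> parcs G}" for u
    by (rule finite_subset[OF _ pair_finite_verts]) (auto dest: in_arcsD2)
  ultimately have "card (parcs G) = (\<Sum>u\<in>pverts G. vdeg G u)"
    using card_SigmaI[OF pair_finite_verts, of "\<lambda>u. {v. (u, v) \<in> parcs G}"]
    by (simp add: vdeg_eq_card)
  moreover have "even (card (parcs G))"
    using pair_sym_arcs
    by (intro even_card_sym_irrefl)
      (auto simp: pair_finite_arcs symmetric_def irrefl_def dest: pair_no_loops)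
  ultimately show ?thesis by simp
qed

section \<open>Existence of a member of \<open>K_family\<close> through its complement\<close>

text \<open>\<open>N i\<close> lists the vertices not adjacent to \<open>i\<close>; joining
  \<open>i\<close> to everything else gives the stated degree. The bijection \<open>f\<close>
  carries the construction from indices to a vertex set of arbitrary type.\<close>

lemma exists_pair_graph_with_complement:
  fixes N :: "nat \<Rightarrow> nat set"
  assumes V: "finite V" "card V = n"
    and N: "\<And>i. i < n \<Longrightarrow> N i \<subseteq> {..<n} - {i}"
    and sym: "\<And>i j. i < n \<Longrightarrow> j \<in> N i \<Longrightarrow> i \<in> N j"
  obtains H f where "pair_graph H" "pverts H = V" "bij_betw f {..<n} V"
    "\<And>i. i < n \<Longrightarrow> vdeg H (f i) = n - 1 - card (N i)"
proof -
  obtain f where f: "bij_betw f {..<n} V"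
    using ex_bij_betw_nat_finite[OF V(1)] V(2) by (auto simp: lessThan_atLeast0)
  define E where "E = {(i, j). i < n \<and> j < n \<and> i \<noteq> j \<and> j \<notin> N i}"
  define H where "H = \<lparr>pverts = V, parcs = map_prod f f ` E\<rparr>"
  have inj: "inj_on f {..<n}" and im: "f ` {..<n} = V"
    using f by (auto simp: bij_betw_def)
  have inV: "f i \<in> V" if "i < n" for i using im that by auto
  have finE: "finite E"
    by (rule finite_subset[of _ "{..<n} \<times> {..<n}"]) (auto simp: E_def)
  have sE: "(j, i) \<in> E" if "(i, j) \<in> E" for i j
    using that sym by (auto simp: E_def)
  have "pair_graph H"
  proof
    show "symmetric (with_proj H)"
      using sE by (force simp: symmetric_def sym_def H_def)
  qed (use V inV finE inj in \<open>auto simp: H_def E_def dest: inj_onD\<close>)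
  moreover have "vdeg H (f i) = n - 1 - card (N i)" if i: "i < n" for i
  proof -
    have "{v. (f i, v) \<in> parcs H} = f ` ({..<n} - insert i (N i))"
      using i inj by (force simp: H_def E_def dest: inj_onD)
    then have "vdeg H (f i) = card ({..<n} - insert i (N i))"
      unfolding vdeg_eq_card by (simp add: card_image inj_on_subset[OF inj])
    also have "\<dots> = n - card (insert i (N i))"
      using N[OF i] i by (subst card_Diff_subset) (auto intro: finite_subset)
    also have "card (insert i (N i)) = Suc (card (N i))"
      using N[OF i] by (subst card_insert_disjoint) (auto intro: finite_subset)
    finally show ?thesis by simp
  qed
  ultimately show ?thesis using that f by (simp add: H_def)
qed

text \<open>
  The complement graph on \<open>{0..\<Delta> + 1}\<close>: \<open>\<Delta> + 1\<close> is the centre of the star, \<open>\<delta>, \<dots>, \<Delta>\<close> are its leaves,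
  and \<open>2k\<close> is matched with \<open>2k + 1\<close> below \<open>\<delta>\<close>; for odd \<open>\<delta>\<close> this matches \<open>\<delta> - 1\<close> with the leaf \<open>\<delta>\<close>.
\<close>

definition co_nbrs :: "nat \<Rightarrow> nat \<Rightarrow> nat \<Rightarrow> nat set" where
  "co_nbrs \<delta> \<Delta> i =
     (if i < \<delta> then {if even i then i + 1 else i - 1}
      else if i = \<Delta> + 1 then {\<delta>..\<Delta>}
      else if i = \<delta> \<and> odd \<delta> then {\<delta> - 1, \<Delta> + 1}
      else {\<Delta> + 1})"

lemma co_nbrs_sym:
  assumes "\<delta> < \<Delta>" "i < \<Delta> + 2" "j \<in> co_nbrs \<delta> \<Delta> i"
  shows "i \<in> co_nbrs \<delta> \<Delta> j"
proof -
  \<comment> \<open>The one delicate case: the partner \<open>i + 1\<close> of an even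
    \<open>i\<close> below \<delta> may fail to lie below \<delta>. Then it is the leaf \<delta>,
    which has \<delta> - 1 as a co-neighbour.\<close>
  have "even i \<Longrightarrow> \<not> i + 1 < \<delta> \<Longrightarrow> i < \<delta> \<Longrightarrow> odd \<delta> \<and> i + 1 = \<delta>"
    by (cases "i + 1 = \<delta>") auto
  then show ?thesis
    using assms by (auto simp: co_nbrs_def split: if_splits)
qed

text \<open>A vertex with c co-neighbours gets degree \<Delta> + 1 - c. The centre has \<Delta> + 1
  - \<delta> of them, the leaf \<delta> has two when \<delta> is odd, and every other vertex has
  one. The set \<open>V\<close> supplies enough elements of the vertex type.\<close>

lemma K_family_nonempty:
  fixes V :: "'a set"
  assumes "\<delta> < \<Delta>" and V: "finite V" "card V = \<Delta> + 2"
  obtains H :: "'a pair_pre_digraph" where "H \<in> K_family \<delta> \<Delta>"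
proof -
  have "co_nbrs \<delta> \<Delta> i \<subseteq> {..<\<Delta> + 2} - {i}" if "i < \<Delta> + 2" for i
    using that \<open>\<delta> < \<Delta>\<close> by (auto simp: co_nbrs_def elim: oddE)
  then obtain H f where H: "pair_graph H" "pverts H = V" and f: "bij_betw f {..<\<Delta> + 2} V"
    and deg: "\<And>i. i < \<Delta> + 2 \<Longrightarrow> vdeg H (f i) = \<Delta> + 2 - 1 - card (co_nbrs \<delta> \<Delta> i)"
    using exists_pair_graph_with_complement[OF V, of "co_nbrs \<delta> \<Delta>"] co_nbrs_sym[OF \<open>\<delta> < \<Delta>\<close>]
    by metis
  have inj: "inj_on f {..<\<Delta> + 2}" and im: "f ` {..<\<Delta> + 2} = V"
    using f by (auto simp: bij_betw_def)
  let ?w = "f (\<Delta> + 1)"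
  have w: "?w \<in> V" "vdeg H ?w = \<delta>"
    using im \<open>\<delta> < \<Delta>\<close> by (auto simp: deg co_nbrs_def)
  have z: "f \<delta> \<in> V - {?w}" "odd \<delta> \<Longrightarrow> vdeg H (f \<delta>) = \<Delta> - 1"
    using im \<open>\<delta> < \<Delta>\<close> inj_onD[OF inj, of \<delta> "\<Delta> + 1"] by (auto simp: deg co_nbrs_def)
  have rest: "vdeg H u = \<Delta>" if u: "u \<in> V - {?w}" "odd \<delta> \<Longrightarrow> u \<noteq> f \<delta>" for u
  proof -
    obtain i where "i < \<Delta> + 2" "u = f i" using u(1) im by auto
    with u show ?thesis by (auto simp: deg co_nbrs_def)
  qed
  have "H \<in> K_family \<delta> \<Delta>"
  proof (cases "even \<delta>")
    case True
    then show ?thesis using H V w rest by (auto simp: K_family_def)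
  next
    case False
    then have "\<exists>z\<in>V - {?w}. vdeg H z = \<Delta> - 1 \<and> (\<forall>u\<in>V - {?w, z}. vdeg H u = \<Delta>)"
      using z rest by (intro bexI[of _ "f \<delta>"]) auto
    with False show ?thesis unfolding K_family_def using H V w by auto
  qed
  then show ?thesis by (rule that)
qed

section \<open>Members of \<open>K_family\<close>: their extreme degrees and their index\<close>

lemma K_family_subset_graph_family:
  assumes "\<delta> < \<Delta>"
  shows "K_family \<delta> \<Delta> \<subseteq> graph_family (\<Delta> + 2) \<delta> \<Delta>"
proof
  fix G :: "'a pair_pre_digraph"
  assume "G \<in> K_family \<delta> \<Delta>"
  \<comment> \<open>Choosing \<open>z = w\<close> for even \<delta> lets both parities share one
    description.\<close>
  then obtain w z where G: "pair_graph G" "card (pverts G) = \<Delta> + 2"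
    and w: "w \<in> pverts G" "vdeg G w = \<delta>"
    and z: "odd \<delta> \<Longrightarrow> vdeg G z = \<Delta> - 1"
    and rest: "\<And>u. u \<in> pverts G - {w, z} \<Longrightarrow> vdeg G u = \<Delta>"
    and ev: "even \<delta> \<Longrightarrow> z = w"
    unfolding K_family_def by (cases "even \<delta>") auto
  have fin: "finite (pverts G)" using G(2) by (simp add: card_ge_0_finite)
  have deg: "\<delta> \<le> vdeg G u \<and> vdeg G u \<le> \<Delta>" if "u \<in> pverts G" for u
    using that rest[of u] w z ev assms by (cases "even \<delta>"; cases "u = w"; cases "u = z") auto
  \<comment> \<open>At most two vertices are exceptional and there are at least three, so the degree
    \<Delta> is attained.\<close>
  have "card {w, z} < card (pverts G)"
    using G(2) assms by (simp add: card_insert_if)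
  then obtain x where "x \<in> pverts G - {w, z}"
    by (metis DiffI card_mono finite.emptyI finite.insertI leD subsetI)
  with rest have x: "x \<in> pverts G" "vdeg G x = \<Delta>" by auto
  have "min_deg G = \<delta>" unfolding min_deg_def
    using fin deg w by (intro Min_eqI) auto
  moreover have "max_deg G = \<Delta>" unfolding max_deg_def
    using fin deg x by (intro Max_eqI) auto
  ultimately show "G \<in> graph_family (\<Delta> + 2) \<delta> \<Delta>"
    using G by (simp add: graph_family_def)
qed

text \<open>The common value of the index on \<open>K_family\<close>. Naming it allows the lower
  bound and its equality case to be proved without reference to a member of the family.\<close>

definition K_value :: "nat \<Rightarrow> nat \<Rightarrow> (nat \<Rightarrow> real) \<Rightarrow> real" where
  "K_value \<delta> \<Delta> h =
     (if even \<delta> then h \<delta> + real (\<Delta> + 1) * h \<Delta> else h \<delta> + h (\<Delta> - 1) + real \<Delta> * h \<Delta>)"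

lemma J_index_remove1:
  assumes "finite (pverts G)" "w \<in> pverts G"
  shows "J_index h G = h (vdeg G w) + (\<Sum>u\<in>pverts G - {w}. h (vdeg G u))"
  unfolding J_index_def using assms by (rule sum.remove)

lemma J_index_remove2:
  assumes "finite (pverts G)" "w \<in> pverts G" "z \<in> pverts G - {w}"
  shows "J_index h G
    = h (vdeg G w) + h (vdeg G z) + (\<Sum>u\<in>pverts G - {w, z}. h (vdeg G u))"
  using assms sum.remove[of "pverts G - {w}" z "\<lambda>u. h (vdeg G u)"]
  by (simp add: J_index_remove1 Diff_insert2[symmetric] insert_commute)

lemma J_index_K_family:
  assumes "G \<in> K_family \<delta> \<Delta>"
  shows "J_index h G = K_value \<delta> \<Delta> h"
proof -
  have card: "card (pverts G) = \<Delta> + 2" using assms by (simp add: K_family_def)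
  then have fin: "finite (pverts G)" by (simp add: card_ge_0_finite)
  obtain w where w: "w \<in> pverts G" "vdeg G w = \<delta>"
    and rest: "if even \<delta> then \<forall>u \<in> pverts G - {w}. vdeg G u = \<Delta>
             else \<exists>z \<in> pverts G - {w}. vdeg G z = \<Delta> - 1 \<and>
                    (\<forall>u \<in> pverts G - {w, z}. vdeg G u = \<Delta>)"
    using assms by (auto simp: K_family_def)
  show ?thesis
  proof (cases "even \<delta>")
    case True
    then show ?thesis
      using fin w rest card by (simp add: J_index_remove1[of G w] K_value_def)
  next
    case False
    with rest obtain z where "z \<in> pverts G - {w}" "vdeg G z = \<Delta> - 1"
      "\<forall>u \<in> pverts G - {w, z}. vdeg G u = \<Delta>" by auto
    with False show ?thesis
      using fin w card by (auto simp: J_index_remove2[of G w z] K_value_def card_Diff_subset card_insert_if)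
  qed
qed

section \<open>The lower bound and its equality case\<close>

lemma graph_familyE:
  assumes "G \<in> graph_family (\<Delta> + 2) \<delta> \<Delta>"
  obtains w where "finite (pverts G)" "w \<in> pverts G" "vdeg G w = \<delta>"
    "\<And>u. u \<in> pverts G \<Longrightarrow> \<delta> \<le> vdeg G u \<and> vdeg G u \<le> \<Delta>"
    "odd \<delta> \<Longrightarrow> \<exists>z\<in>pverts G - {w}. vdeg G z \<le> \<Delta> - 1"
proof -
  have G: "pair_graph G" "card (pverts G) = \<Delta> + 2" "min_deg G = \<delta>" "max_deg G = \<Delta>"
    using assms by (auto simp: graph_family_def)
  have fin: "finite (pverts G)" using G(2) by (simp add: card_ge_0_finite)
  have ne: "pverts G \<noteq> {}" using G(2) by auto
  have deg: "\<delta> \<le> vdeg G u \<and> vdeg G u \<le> \<Delta>" if "u \<in> pverts G" for u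
    using that fin G(3,4) by (auto simp: min_deg_def max_deg_def)
  have "min_deg G \<in> vdeg G ` pverts G"
    unfolding min_deg_def using fin ne by (intro Min_in) auto
  then obtain w where w: "w \<in> pverts G" "vdeg G w = \<delta>" using G(3) by auto
  have "\<exists>z\<in>pverts G - {w}. vdeg G z \<le> \<Delta> - 1" if "odd \<delta>"
  proof (rule ccontr)
    assume "\<not> ?thesis"
    with deg have "vdeg G u = \<Delta>" if "u \<in> pverts G - {w}" for u
      using that by force
    then have "(\<Sum>u\<in>pverts G. vdeg G u) = \<delta> + (\<Delta> + 1) * \<Delta>"
      using fin w G(2) by (simp add: sum.remove[of _ w])
    \<comment> \<open>A product of consecutive integers is even, so the degree sum would have the
      parity of \<delta>, that is, be odd.\<close>
    moreover have "even ((\<Delta> + 1) * \<Delta>)" by simp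
    ultimately show False
      using handshake_even[OF G(1)] \<open>odd \<delta>\<close> by (metis even_add)
  qed
  then show ?thesis using that fin w deg by blast
qed

lemma K_value_le_J_index:
  assumes "1 \<le> \<delta>" "\<delta> < \<Delta>" and h: "\<And>j k. 1 \<le> j \<Longrightarrow> j \<le> k \<Longrightarrow> h k \<le> h j"
    and G: "G \<in> graph_family (\<Delta> + 2) \<delta> \<Delta>"
  shows "K_value \<delta> \<Delta> h \<le> J_index h G"
proof -
  obtain w where fin: "finite (pverts G)" and w: "w \<in> pverts G" "vdeg G w = \<delta>"
    and deg: "\<And>u. u \<in> pverts G \<Longrightarrow> \<delta> \<le> vdeg G u \<and> vdeg G u \<le> \<Delta>"
    and odd: "odd \<delta> \<Longrightarrow> \<exists>z\<in>pverts G - {w}. vdeg G z \<le> \<Delta> - 1"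
    using graph_familyE[OF G] by metis
  have card: "card (pverts G) = \<Delta> + 2" using G by (simp add: graph_family_def)
  have hle: "h \<Delta> \<le> h (vdeg G u)" if "u \<in> pverts G" for u
    using deg[OF that] \<open>1 \<le> \<delta>\<close> by (intro h) auto
  \<comment> \<open>\<open>A\<close> collects the vertices estimated separately: \<open>{w}\<close>
    for even \<delta> and \<open>{w, z}\<close> for odd \<delta>.\<close>
  have le: "real (card (pverts G - A)) * h \<Delta> \<le> (\<Sum>u\<in>pverts G - A. h (vdeg G u))" for A
    by (rule sum_bounded_below) (use hle in auto)
  show ?thesis
  proof (cases "even \<delta>")
    case True
    then show ?thesis
      using le[of "{w}"] fin w card by (simp add: J_index_remove1[of G w] K_value_def)
  next
    case False
    then obtain z where z: "z \<in> pverts G - {w}" "vdeg G z \<le> \<Delta> - 1" using odd by auto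
    have "h (\<Delta> - 1) \<le> h (vdeg G z)"
      using deg[of z] z \<open>1 \<le> \<delta>\<close> by (intro h) auto
    with False show ?thesis
      using le[of "{w, z}"] fin w card z
      by (auto simp: J_index_remove2[of G w z] K_value_def card_Diff_subset card_insert_if)
  qed
qed

text \<open>The lower bound is a sum of vertexwise bounds, so reaching it forces equality in each.
  Strict decrease of \<open>h\<close> just below the extremal degrees turns equal values into equal
  degrees.\<close>

lemma in_K_family_if_J_index_le:
  assumes "1 \<le> \<delta>" "\<delta> < \<Delta>" and h: "\<And>j k. 1 \<le> j \<Longrightarrow> j \<le> k \<Longrightarrow> h k \<le> h j"
    and strict: "h (\<Delta> - 1) > h \<Delta>" "odd \<delta> \<Longrightarrow> h (\<Delta> - 2) > h (\<Delta> - 1)"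
    and G: "G \<in> graph_family (\<Delta> + 2) \<delta> \<Delta>" and le: "J_index h G \<le> K_value \<delta> \<Delta> h"
  shows "G \<in> K_family \<delta> \<Delta>"
proof -
  obtain w where fin: "finite (pverts G)" and w: "w \<in> pverts G" "vdeg G w = \<delta>"
    and deg: "\<And>u. u \<in> pverts G \<Longrightarrow> \<delta> \<le> vdeg G u \<and> vdeg G u \<le> \<Delta>"
    and odd: "odd \<delta> \<Longrightarrow> \<exists>z\<in>pverts G - {w}. vdeg G z \<le> \<Delta> - 1"
    using graph_familyE[OF G] by metis
  have card: "card (pverts G) = \<Delta> + 2" and pg: "pair_graph G"
    using G by (auto simp: graph_family_def)
  have hle: "h \<Delta> \<le> h (vdeg G u)" if "u \<in> pverts G" for u
    using deg[OF that] \<open>1 \<le> \<delta>\<close> by (intro h) auto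
  \<comment> \<open>A single degree below \<Delta> contributes at least
    \<open>h (\<Delta> - 1)\<close>, which exceeds \<open>h \<Delta>\<close>, while no other term
    drops below \<open>h \<Delta>\<close>.\<close>
  have all_eq: "vdeg G u = \<Delta>"
    if "(\<Sum>u\<in>pverts G - A. h (vdeg G u)) \<le> real (card (pverts G - A)) * h \<Delta>"
      and u: "u \<in> pverts G - A" for A u
  proof (rule ccontr)
    assume "vdeg G u \<noteq> \<Delta>"
    with deg[of u] u \<open>1 \<le> \<delta>\<close> have "h (\<Delta> - 1) \<le> h (vdeg G u)" by (intro h) auto
    with strict(1) have "h \<Delta> < h (vdeg G u)" by simp
    then have "(\<Sum>u\<in>pverts G - A. h \<Delta>) < (\<Sum>u\<in>pverts G - A. h (vdeg G u))"
      using fin u hle by (intro sum_strict_mono_ex1) auto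
    with that(1) show False by simp
  qed
  show ?thesis
  proof (cases "even \<delta>")
    case True
    have "vdeg G u = \<Delta>" if "u \<in> pverts G - {w}" for u
      using le True fin w card that
      by (intro all_eq[of "{w}"]) (auto simp: J_index_remove1[of G w] K_value_def)
    with True pg card w show ?thesis by (auto simp: K_family_def)
  next
    case False
    then obtain z where z: "z \<in> pverts G - {w}" "vdeg G z \<le> \<Delta> - 1" using odd by auto
    have hz: "h (\<Delta> - 1) \<le> h (vdeg G z)"
      using deg[of z] z \<open>1 \<le> \<delta>\<close> by (intro h) auto
    \<comment> \<open>The term \<open>h \<delta>\<close> of \<open>w\<close> cancels. Both summands
      left are at least their counterparts on the right, so each is also at most its
      counterpart.\<close>
    have J: "h (vdeg G z) + (\<Sum>u\<in>pverts G - {w, z}. h (vdeg G u))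
        \<le> h (\<Delta> - 1) + real (card (pverts G - {w, z})) * h \<Delta>"
      using le False fin w card z
      by (auto simp: J_index_remove2[of G w z] K_value_def card_Diff_subset card_insert_if)
    have "real (card (pverts G - {w, z})) * h \<Delta> \<le> (\<Sum>u\<in>pverts G - {w, z}. h (vdeg G u))"
      by (rule sum_bounded_below) (use hle in auto)
    with J have "h (vdeg G z) \<le> h (\<Delta> - 1)" by simp
    have "vdeg G z = \<Delta> - 1"
    proof (rule ccontr)
      assume "vdeg G z \<noteq> \<Delta> - 1"
      \<comment> \<open>Here 1 \<le> \<delta> \<le> \<open>vdeg G z\<close> \<le> \<Delta> - 2. For
        \<Delta> = 2 the assumptions already conflict, so the value \<open>h 0\<close> is never
        compared by monotonicity.\<close>
      with z deg[of z] \<open>1 \<le> \<delta>\<close> have "h (\<Delta> - 2) \<le> h (vdeg G z)" by (intro h) auto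
      with strict(2) False \<open>h (vdeg G z) \<le> h (\<Delta> - 1)\<close> show False by simp
    qed
    moreover have "vdeg G u = \<Delta>" if "u \<in> pverts G - {w, z}" for u
      using J hz that by (intro all_eq[of "{w, z}"]) auto
    ultimately show ?thesis using False pg card w z by (auto simp: K_family_def)
  qed
qed

theorem theorem2p13:
  fixes \<delta> \<Delta> :: nat and h :: "nat \<Rightarrow> real"
  assumes "1 \<le> \<delta>" and "\<delta> < \<Delta>"
    and h_pos: "\<And>k. 1 \<le> k \<Longrightarrow> 0 < h k"
    and h_noninc: "\<And>j k. 1 \<le> j \<Longrightarrow> j \<le> k \<Longrightarrow> h k \<le> h j"
  shows "(\<forall>G :: 'a pair_pre_digraph. G \<in> K_family \<delta> \<Delta> \<longrightarrow>
            minimal_on (J_index h) (graph_family (\<Delta> + 2) \<delta> \<Delta>) G) \<and>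
         ((even \<delta> \<and> h (\<Delta> - 1) > h \<Delta>) \<or>
          (odd \<delta> \<and> h (\<Delta> - 2) > h (\<Delta> - 1) \<and> h (\<Delta> - 1) > h \<Delta>) \<longrightarrow>
          (\<forall>G :: 'a pair_pre_digraph. G \<in> graph_family (\<Delta> + 2) \<delta> \<Delta> \<longrightarrow>
            (minimal_on (J_index h) (graph_family (\<Delta> + 2) \<delta> \<Delta>) G \<longleftrightarrow> G \<in> K_family \<delta> \<Delta>)))"
proof -
  have minimal: "minimal_on (J_index h) (graph_family (\<Delta> + 2) \<delta> \<Delta>) G"
    if "G \<in> K_family \<delta> \<Delta>" for G :: "'a pair_pre_digraph"
    using that K_family_subset_graph_family[OF assms(2)]
      K_value_le_J_index[OF assms(1,2), of h] h_noninc
    by (auto simp: minimal_on_def J_index_K_family)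
  have "G \<in> K_family \<delta> \<Delta>"
    if strict: "(even \<delta> \<and> h (\<Delta> - 1) > h \<Delta>) \<or>
        (odd \<delta> \<and> h (\<Delta> - 2) > h (\<Delta> - 1) \<and> h (\<Delta> - 1) > h \<Delta>)"
      and G: "G \<in> graph_family (\<Delta> + 2) \<delta> \<Delta>"
      and min: "minimal_on (J_index h) (graph_family (\<Delta> + 2) \<delta> \<Delta>) G"
    for G :: "'a pair_pre_digraph"
  proof -
    have card: "card (pverts G) = \<Delta> + 2" using G by (simp add: graph_family_def)
    then have "finite (pverts G)" by (simp add: card_ge_0_finite)
    \<comment> \<open>The vertex set of \<open>G\<close> itself provides the \<Delta> + 2 elements
      of \<open>'a\<close> on which a competitor in \<open>K_family\<close> is built.\<close>
    then obtain H :: "'a pair_pre_digraph" where H: "H \<in> K_family \<delta> \<Delta>"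
      using K_family_nonempty[OF assms(2)] card by metis
    then have "J_index h G \<le> J_index h H"
      using min K_family_subset_graph_family[OF assms(2)] by (auto simp: minimal_on_def)
    then show ?thesis
      using strict by (intro in_K_family_if_J_index_le[OF assms(1,2) h_noninc _ _ G])
        (auto simp: J_index_K_family[OF H])
  qed
  with minimal show ?thesis by blast
qed

end
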